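(* Let $D\subset \ell^\infty$ be a subspace with $D\cap c=\{0\}$, and let $q:\ell^\infty\to \ell^\infty/c$ be the quotient map. Assume that $q(D)$ is separable in $\ell^\infty/c$. Then for every separable Banach space $E$ there exists an isometry $T:E\to\ell^\infty$ such that $$T(E)\cap (D+c)=\{0\}.$$ In particular, for $Z:=D+T(E)$ we have $Z\cap c=\{0\}$.
   Context: The scalar field is $\mathbb{K}=\mathbb{R}$ or $\mathbb{C}$. $\ell^\infty$ is the Banach space of all bounded $\mathbb{K}$-valued sequences $(x_n)_{n=1}^\infty$ with the sup norm $\|\cdot\|_\infty$, $c\subset\ell^\infty$ is the (closed) subspace of convergent sequences, and $\ell^\infty/c$ carries the quotient norm. Subspace means linear subspace (not necessarily closed). "Isometry $T:E\to\ell^\infty$" means a linear isometric embedding, not necessarily onto: $T$ is linear and $\|T(x)\|_\infty=\|x\|$ for all $x\in E$. *)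

theory Defs
  imports "HOL-Analysis.Analysis"
begin

section \<open>The scalar field\<close>

text \<open>
  A type of this class is a copy of \<open>real\<close> or \<open>complex\<close> as a normed field: the embedding \<open>\<phi>\<close> is
  a norm-preserving real-linear ring homomorphism into \<open>complex\<close> whose range is the real line or
  all of \<open>complex\<close>.
\<close>

class real_or_complex = real_normed_field + banach +
  assumes ex_real_or_complex_embedding:
    "\<exists>\<phi> :: 'a \<Rightarrow> complex.
       (\<forall>x y. \<phi> (x + y) = \<phi> x + \<phi> y) \<and> (\<forall>x y. \<phi> (x * y) = \<phi> x * \<phi> y) \<and>
       (\<forall>r x. \<phi> (r *\<^sub>R x) = r *\<^sub>R \<phi> x) \<and> (\<forall>x. norm (\<phi> x) = norm x) \<and>
       (range \<phi> = \<real> \<or> range \<phi> = UNIV)"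

instance real :: real_or_complex
proof
  show "\<exists>\<phi> :: real \<Rightarrow> complex.
       (\<forall>x y. \<phi> (x + y) = \<phi> x + \<phi> y) \<and> (\<forall>x y. \<phi> (x * y) = \<phi> x * \<phi> y) \<and>
       (\<forall>r x. \<phi> (r *\<^sub>R x) = r *\<^sub>R \<phi> x) \<and> (\<forall>x. norm (\<phi> x) = norm x) \<and>
       (range \<phi> = \<real> \<or> range \<phi> = UNIV)"
    by (rule exI[of _ complex_of_real]) (auto simp: Reals_def scaleR_conv_of_real)
qed

instance complex :: real_or_complex
proof
  show "\<exists>\<phi> :: complex \<Rightarrow> complex.
       (\<forall>x y. \<phi> (x + y) = \<phi> x + \<phi> y) \<and> (\<forall>x y. \<phi> (x * y) = \<phi> x * \<phi> y) \<and>
       (\<forall>r x. \<phi> (r *\<^sub>R x) = r *\<^sub>R \<phi> x) \<and> (\<forall>x. norm (\<phi> x) = norm x) \<and>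
       (range \<phi> = \<real> \<or> range \<phi> = UNIV)"
    by (rule exI[of _ "\<lambda>x. x"]) auto
qed


section \<open>Normed spaces over the scalar field\<close>

text \<open>
  The library classes \<open>real_normed_vector\<close> and \<open>banach\<close> only know real scalars. A normed space
  over \<open>'k\<close> is a type of class \<open>real_normed_vector\<close> with a scalar multiplication by \<open>'k\<close> for
  which the norm is homogeneous; the last axiom says that the real structure of the type is the
  restriction of scalars along \<open>of_real\<close>. It is a Banach space if the type is of class \<open>banach\<close>.
\<close>

locale normed_space_over = vector_space scale
  for scale :: "'k::real_or_complex \<Rightarrow> 'e::real_normed_vector \<Rightarrow> 'e" +
  assumes norm_scale: "norm (scale a x) = norm a * norm x"
    and scale_of_real: "scale (of_real r) x = r *\<^sub>R x"


section \<open>Bounded sequences\<close>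

text \<open>
  Every function on the discrete space \<open>nat\<close> is continuous, so the bounded continuous functions
  on \<open>nat\<close>, with the supremum norm, are the bounded sequences. Indices start at 0.
\<close>

type_synonym 'k linf = "nat \<Rightarrow>\<^sub>C 'k"

definition scale_linf :: "'k::real_or_complex \<Rightarrow> 'k linf \<Rightarrow> 'k linf"
  where "scale_linf a x = Bcontfun (\<lambda>n. a * apply_bcontfun x n)"

lemma apply_scale_linf [simp]:
  "apply_bcontfun (scale_linf a x) n = a * apply_bcontfun x n"
proof -
  have "(\<lambda>n. a * apply_bcontfun x n) \<in> bcontfun"
    by (rule bcontfun_normI[where b = "norm a * norm x"])
      (auto simp: norm_mult norm_bounded intro!: mult_left_mono continuous_intros)
  then show ?thesis
    by (simp add: scale_linf_def Bcontfun_inverse)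
qed

lemma norm_linf: "norm (x :: 'k::real_normed_vector linf) = (SUP n. norm (apply_bcontfun x n))"
  by (simp add: norm_bcontfun_def dist_bcontfun.rep_eq)

interpretation linf: normed_space_over scale_linf
proof
  fix a :: 'a and x :: "'a linf"
  show "norm (scale_linf a x) = norm a * norm x"
  proof (cases "a = 0")
    case True
    then have "scale_linf a x = 0" by (auto intro: bcontfun_eqI)
    with True show ?thesis by simp
  next
    case False
    have le: "norm (scale_linf b y) \<le> norm b * norm y" for b :: 'a and y :: "'a linf"
      by (rule norm_bound) (auto simp: norm_mult norm_bounded intro!: mult_left_mono)
    have "x = scale_linf (inverse a) (scale_linf a x)"
      using False by (auto intro!: bcontfun_eqI)
    then have "norm x \<le> norm (inverse a) * norm (scale_linf a x)"
      using le by metis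
    then have "norm a * norm x \<le> norm (scale_linf a x)"
      using False by (simp add: norm_inverse inverse_eq_divide norm_divide field_simps)
    with le[of a x] show ?thesis by simp
  qed
qed (auto intro!: bcontfun_eqI simp: algebra_simps scaleR_conv_of_real)

definition conv_seqs :: "'k::real_or_complex linf set"
  where "conv_seqs = {x. convergent (apply_bcontfun x)}"

lemma subspace_conv_seqs: "linf.subspace (conv_seqs :: 'k::real_or_complex linf set)"
  unfolding linf.subspace_def conv_seqs_def
  by (auto simp: convergent_const apply_scale_linf[abs_def] plus_bcontfun.rep_eq[abs_def]
      zero_bcontfun.rep_eq[abs_def] intro: convergent_add convergent_mult)

lemma conv_seqs_add: "x \<in> conv_seqs \<Longrightarrow> y \<in> conv_seqs \<Longrightarrow> x + y \<in> conv_seqs"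
  using subspace_conv_seqs by (rule linf.subspace_add)

lemma conv_seqs_uminus: "x \<in> conv_seqs \<Longrightarrow> - x \<in> conv_seqs"
  using subspace_conv_seqs by (rule linf.subspace_neg)

lemma conv_seqs_0: "0 \<in> conv_seqs"
  using subspace_conv_seqs by (rule linf.subspace_0)

lemma conv_seqs_diff: "x \<in> conv_seqs \<Longrightarrow> y \<in> conv_seqs \<Longrightarrow> x - y \<in> conv_seqs"
  using subspace_conv_seqs by (rule linf.subspace_diff)

lemma conv_seqs_scaleR: "x \<in> conv_seqs \<Longrightarrow> r *\<^sub>R x \<in> conv_seqs"
  using linf.subspace_scale[OF subspace_conv_seqs, of x "of_real r"]
  by (simp add: linf.scale_of_real)

lemma closed_conv_seqs: "closed (conv_seqs :: 'k::real_or_complex linf set)"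
  unfolding closed_sequential_limits
proof safe
  fix f :: "nat \<Rightarrow> 'k linf" and l
  assume f: "\<forall>n. f n \<in> conv_seqs" and l: "f \<longlonglongrightarrow> l"
  have "Cauchy (apply_bcontfun l)"
  proof (rule metric_CauchyI)
    fix e :: real assume "e > 0"
    then have "e / 3 > 0" by simp
    with l obtain n where n: "dist (f n) l < e / 3"
      by (meson LIMSEQ_iff_nz lim_sequentially order_refl)
    have "Cauchy (apply_bcontfun (f n))"
      using f by (auto simp: conv_seqs_def intro: convergent_Cauchy)
    then obtain M where
      M: "\<And>i j. i \<ge> M \<Longrightarrow> j \<ge> M \<Longrightarrow> dist (apply_bcontfun (f n) i) (apply_bcontfun (f n) j) < e / 3"
      using \<open>e / 3 > 0\<close> by (meson metric_CauchyD)
    have "dist (apply_bcontfun l i) (apply_bcontfun l j) < e" if "i \<ge> M" "j \<ge> M" for i j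
    proof -
      have "dist (apply_bcontfun (f n) i) (apply_bcontfun l i) < e / 3"
        "dist (apply_bcontfun (f n) j) (apply_bcontfun l j) < e / 3"
        using n dist_fun_lt_imp_dist_val_lt by blast+
      with M[OF that] show ?thesis
        by metric
    qed
    then show "\<exists>M. \<forall>i\<ge>M. \<forall>j\<ge>M. dist (apply_bcontfun l i) (apply_bcontfun l j) < e"
      by blast
  qed
  then show "l \<in> conv_seqs"
    by (simp add: conv_seqs_def Cauchy_convergent_iff)
qed


section \<open>The quotient by the convergent sequences\<close>

quotient_type (overloaded) 'k linf_mod_c = "'k::real_or_complex linf" /
  "\<lambda>x y. x - y \<in> (conv_seqs :: 'k linf set)"
proof (rule equivpI)
  show "reflp (\<lambda>x y. x - y \<in> (conv_seqs :: 'k linf set))"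
    by (rule reflpI) (simp add: conv_seqs_0)
  show "symp (\<lambda>x y. x - y \<in> (conv_seqs :: 'k linf set))"
    by (rule sympI) (metis conv_seqs_uminus minus_diff_eq)
  show "transp (\<lambda>x y. x - y \<in> (conv_seqs :: 'k linf set))"
  proof (rule transpI)
    fix x y z :: "'k linf"
    assume "x - y \<in> conv_seqs" "y - z \<in> conv_seqs"
    then have "(x - y) + (y - z) \<in> conv_seqs" by (rule conv_seqs_add)
    then show "x - z \<in> conv_seqs" by simp
  qed
qed

lift_definition quot_c :: "'k::real_or_complex linf \<Rightarrow> 'k linf_mod_c" is "\<lambda>x. x" .

lemma quot_c_surj: "\<exists>x. X = quot_c x"
  by transfer (metis conv_seqs_0 diff_self)

lemma quot_c_eq_iff: "quot_c x = quot_c y \<longleftrightarrow> x - y \<in> conv_seqs"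
  by transfer simp

lemma infdist_conv_seqs_cong:
  assumes "x - y \<in> (conv_seqs :: 'k::real_or_complex linf set)"
  shows "infdist x conv_seqs = infdist y (conv_seqs :: 'k linf set)"
proof -
  have le: "infdist u conv_seqs \<le> infdist v (conv_seqs :: 'k linf set)"
    if "u - v \<in> conv_seqs" for u v :: "'k linf"
  proof -
    have "infdist u conv_seqs \<le> dist v a" if a: "a \<in> conv_seqs" for a
    proof (rule infdist_le2)
      show "a + (u - v) \<in> conv_seqs" using a \<open>u - v \<in> conv_seqs\<close> by (rule conv_seqs_add)
      show "dist u (a + (u - v)) \<le> dist v a" by (simp add: dist_norm)
    qed
    then show ?thesis
      unfolding infdist_notempty[OF ex_in_conv[THEN iffD1, OF exI, OF conv_seqs_0], of v]
      using conv_seqs_0 by (intro cINF_greatest) auto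
  qed
  have "y - x \<in> conv_seqs" using conv_seqs_uminus[OF assms] by simp
  with assms show ?thesis by (intro antisym le)
qed

instantiation linf_mod_c :: (real_or_complex) real_vector
begin

lift_definition zero_linf_mod_c :: "'a linf_mod_c" is 0 .

lift_definition plus_linf_mod_c :: "'a linf_mod_c \<Rightarrow> 'a linf_mod_c \<Rightarrow> 'a linf_mod_c" is "(+)"
  by (metis add_diff_add conv_seqs_add)

lift_definition minus_linf_mod_c :: "'a linf_mod_c \<Rightarrow> 'a linf_mod_c \<Rightarrow> 'a linf_mod_c" is "(-)"
  by (metis diff_diff_eq2 diff_add_eq add.commute diff_diff_add conv_seqs_diff)

lift_definition uminus_linf_mod_c :: "'a linf_mod_c \<Rightarrow> 'a linf_mod_c" is uminus
  by (metis conv_seqs_uminus minus_diff_minus)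

lift_definition scaleR_linf_mod_c :: "real \<Rightarrow> 'a linf_mod_c \<Rightarrow> 'a linf_mod_c" is "scaleR"
  by (metis conv_seqs_scaleR scaleR_diff_right)

instance
proof
  fix X Y Z :: "'a linf_mod_c" and r s :: real
  show "X + Y + Z = X + (Y + Z)" by transfer (simp add: conv_seqs_0 algebra_simps)
  show "X + Y = Y + X" by transfer (simp add: conv_seqs_0 algebra_simps)
  show "0 + X = X" by transfer (simp add: conv_seqs_0)
  show "- X + X = 0" by transfer (simp add: conv_seqs_0)
  show "X - Y = X + - Y" by transfer (simp add: conv_seqs_0)
  show "r *\<^sub>R (X + Y) = r *\<^sub>R X + r *\<^sub>R Y" by transfer (simp add: conv_seqs_0 algebra_simps)
  show "(r + s) *\<^sub>R X = r *\<^sub>R X + s *\<^sub>R X" by transfer (simp add: conv_seqs_0 algebra_simps)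
  show "r *\<^sub>R s *\<^sub>R X = (r * s) *\<^sub>R X" by transfer (simp add: conv_seqs_0)
  show "1 *\<^sub>R X = X" by transfer (simp add: conv_seqs_0)
qed

end

instantiation linf_mod_c :: (real_or_complex) real_normed_vector
begin

text \<open>\<open>infdist x S\<close> is the infimum of \<open>dist x a\<close> over \<open>a \<in> S\<close>, here the norm of the coset of \<open>x\<close>.\<close>

lift_definition norm_linf_mod_c :: "'a linf_mod_c \<Rightarrow> real" is "\<lambda>x. infdist x conv_seqs"
  by (rule infdist_conv_seqs_cong)

definition dist_linf_mod_c :: "'a linf_mod_c \<Rightarrow> 'a linf_mod_c \<Rightarrow> real"
  where "dist_linf_mod_c X Y = norm (X - Y)"

definition sgn_linf_mod_c :: "'a linf_mod_c \<Rightarrow> 'a linf_mod_c"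
  where "sgn_linf_mod_c X = X /\<^sub>R norm X"

definition uniformity_linf_mod_c :: "('a linf_mod_c \<times> 'a linf_mod_c) filter"
  where "uniformity_linf_mod_c = (INF e\<in>{0 <..}. principal {(X, Y). dist X Y < e})"

definition open_linf_mod_c :: "'a linf_mod_c set \<Rightarrow> bool"
  where "open_linf_mod_c U = (\<forall>X\<in>U. \<forall>\<^sub>F (X', Y) in uniformity. X' = X \<longrightarrow> Y \<in> U)"

instance
proof
  fix X Y :: "'a linf_mod_c" and r :: real
  have ne: "(conv_seqs :: 'a linf set) \<noteq> {}" using conv_seqs_0 by blast
  show "dist X Y = norm (X - Y)" by (rule dist_linf_mod_c_def)
  show "sgn X = X /\<^sub>R norm X" by (rule sgn_linf_mod_c_def)
  show "norm X = 0 \<longleftrightarrow> X = 0"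
    using in_closed_iff_infdist_zero[OF closed_conv_seqs ne] by transfer simp
  show "norm (X + Y) \<le> norm X + norm Y"
  proof transfer
    fix x y :: "'a linf"
    show "infdist (x + y) conv_seqs \<le> infdist x conv_seqs + infdist y conv_seqs"
    proof (rule field_le_epsilon)
      fix e :: real assume "e > 0"
      have ex: "\<exists>a\<in>conv_seqs. dist z a < infdist z conv_seqs + e / 2" for z :: "'a linf"
        using \<open>e > 0\<close> infdist_notempty[OF ne, of z]
          cInf_lessD[of "dist z ` conv_seqs" "infdist z conv_seqs + e / 2"] ne by auto
      from ex[of x] ex[of y] obtain a b where
        "a \<in> conv_seqs" "dist x a < infdist x conv_seqs + e / 2"
        "b \<in> conv_seqs" "dist y b < infdist y conv_seqs + e / 2" by blast
      moreover from this have "infdist (x + y) conv_seqs \<le> dist (x + y) (a + b)"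
        by (intro infdist_le conv_seqs_add)
      moreover have "dist (x + y) (a + b) \<le> dist x a + dist y b"
        by (rule dist_triangle_add)
      ultimately show "infdist (x + y) conv_seqs \<le> infdist x conv_seqs + infdist y conv_seqs + e"
        by simp
    qed
  qed
  show "norm (r *\<^sub>R X) = \<bar>r\<bar> * norm X"
  proof transfer
    fix r :: real and x :: "'a linf"
    have le: "infdist (t *\<^sub>R y) conv_seqs \<le> \<bar>t\<bar> * infdist y conv_seqs" if "t \<noteq> 0"
      for t :: real and y :: "'a linf"
    proof -
      have "infdist (t *\<^sub>R y) conv_seqs / \<bar>t\<bar> \<le> dist y a" if "a \<in> conv_seqs" for a
        using infdist_le[OF conv_seqs_scaleR[OF that, of t], of "t *\<^sub>R y"] \<open>t \<noteq> 0\<close>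
        by (simp add: dist_norm scaleR_diff_right[symmetric] divide_le_eq mult.commute del: scaleR_diff_right)
      then have "infdist (t *\<^sub>R y) conv_seqs / \<bar>t\<bar> \<le> infdist y conv_seqs"
        unfolding infdist_notempty[OF ne, of y] using ne by (intro cINF_greatest) auto
      then show ?thesis using \<open>t \<noteq> 0\<close> by (simp add: field_simps)
    qed
    show "infdist (r *\<^sub>R x) conv_seqs = \<bar>r\<bar> * infdist x conv_seqs"
    proof (cases "r = 0")
      case True
      then show ?thesis by (simp add: conv_seqs_0)
    next
      case False
      then show ?thesis
        using le[of r x] le[of "inverse r" "r *\<^sub>R x"] by (simp add: field_simps)
    qed
  qed
qed (rule uniformity_linf_mod_c_def open_linf_mod_c_def)+

end

lemma norm_quot_c: "norm (quot_c x) = infdist x conv_seqs"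
  by transfer simp

end

theory Submission
  imports Defs "HOL-Complex_Analysis.Great_Picard"
begin

text \<open>
  Choose a countable \<open>S \<subseteq> D\<close> whose image is dense in the image of \<open>D\<close> in the quotient. By a diagonal
  argument there is a subsequence \<open>r\<close> along which all elements of \<open>S\<close> converge, and then, by density,
  so do all elements of \<open>D + c\<close>. Let \<open>T x\<close> vanish off the range of \<open>r\<close>, and on it take each
  of the values \<open>0, F\<^sub>0 x, F\<^sub>1 x, \<dots>\<close> infinitely often, where \<open>(F\<^sub>n)\<close> is a norming sequence of
  functionals on the separable space. Then \<open>T\<close> is an isometry, and \<open>T x\<close> converges along \<open>r\<close> only
  if all \<open>F\<^sub>n x\<close> vanish, that is, if \<open>x = 0\<close>.
\<close>

section \<open>The Hahn--Banach theorem\<close>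

text \<open>
  A sublinear functional that is minimal among all sublinear functionals is linear, since it is
  not lowered by \<open>tilt\<close> in any direction. A minimal functional below \<open>tilt norm z\<close> attains the
  norm at \<open>z\<close>.
\<close>

definition sublinear :: "('a::real_vector \<Rightarrow> real) \<Rightarrow> bool"
  where "sublinear p \<longleftrightarrow>
    (\<forall>x y. p (x + y) \<le> p x + p y) \<and> (\<forall>r x. 0 < r \<longrightarrow> p (r *\<^sub>R x) \<le> r * p x)"

lemma sublinear_add: "sublinear p \<Longrightarrow> p (x + y) \<le> p x + p y"
  by (simp add: sublinear_def)

lemma sublinear_scaleR:
  assumes "sublinear p" "0 \<le> r"
  shows "p (r *\<^sub>R x) = r * p x"
proof -
  have le: "p (s *\<^sub>R y) \<le> s * p y" if "0 < s" for s y
    using assms that by (simp add: sublinear_def)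
  \<comment> \<open>The scalars 2 and 1/2 bound \<open>p 0\<close> by 0 from below and from
    above.\<close>
  have "p 0 \<le> 2 * p 0" "p 0 \<le> (1/2) * p 0"
    using le[of 2 0] le[of "1/2" 0] by simp_all
  then have 0: "p 0 = 0" by simp
  show ?thesis
  proof (cases "r = 0")
    case False
    then have r: "0 < r" using assms by simp
    have "p x \<le> inverse r * p (r *\<^sub>R x)"
      using le[of "inverse r" "r *\<^sub>R x"] r by simp
    then have "r * p x \<le> p (r *\<^sub>R x)"
      using r by (simp add: field_simps)
    then show ?thesis using le[OF r, of x] by simp
  qed (simp add: 0)
qed

lemma sublinear_0: "sublinear p \<Longrightarrow> p 0 = 0"
  using sublinear_scaleR[of p 0 0] by simp

lemma sublinear_ge_minus: "sublinear p \<Longrightarrow> - p (- x) \<le> p x"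
  using sublinear_add[of p x "- x"] sublinear_0[of p] by simp

lemma sublinear_norm: "sublinear (norm :: 'a::real_normed_vector \<Rightarrow> real)"
  by (simp add: sublinear_def norm_triangle_ineq)

text \<open>For sublinear \<open>p\<close> this is the largest sublinear functional below
  \<open>p\<close> whose value at \<open>- y\<close> is at most \<open>- p y\<close>.\<close>

definition tilt :: "('a::real_vector \<Rightarrow> real) \<Rightarrow> 'a \<Rightarrow> 'a \<Rightarrow> real"
  where "tilt p y x = (INF t\<in>{0..}. p (x + t *\<^sub>R y) - t * p y)"

lemma tilt_le:
  assumes "sublinear p" "0 \<le> t"
  shows "tilt p y x \<le> p (x + t *\<^sub>R y) - t * p y"
  unfolding tilt_def
proof (rule cINF_lower)
  \<comment> \<open>Subadditivity at \<open>x + s *\<^sub>R y\<close> and \<open>- x\<close> gives a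
    lower bound independent of \<open>s\<close>, so the real infimum is genuine.\<close>
  have "- p (- x) \<le> p (x + s *\<^sub>R y) - s * p y" if "0 \<le> s" for s
    using sublinear_add[OF assms(1), of "x + s *\<^sub>R y" "- x"] sublinear_scaleR[OF assms(1) that, of y]
    by simp
  then show "bdd_below ((\<lambda>s. p (x + s *\<^sub>R y) - s * p y) ` {0..})"
    by (auto intro!: bdd_belowI)
qed (use assms in simp)

lemma tilt_greatest:
  assumes "\<And>t. 0 \<le> t \<Longrightarrow> b \<le> p (x + t *\<^sub>R y) - t * p y"
  shows "b \<le> tilt p y x"
  unfolding tilt_def by (rule cINF_greatest) (use assms in auto)

lemma tilt_le_self: "sublinear p \<Longrightarrow> tilt p y x \<le> p x"
  using tilt_le[of p 0 y x] by simp

text \<open>Parameters \<open>s\<close> for \<open>x\<close> and \<open>t\<close> for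
  \<open>x'\<close> combine to \<open>s + t\<close> for \<open>x + x'\<close>; scaling
  \<open>x\<close> by \<open>r\<close> turns the parameter \<open>t\<close> into
  \<open>r * t\<close>.\<close>

lemma sublinear_tilt:
  assumes p: "sublinear p"
  shows "sublinear (tilt p y)"
  unfolding sublinear_def
proof (intro conjI allI impI)
  fix x x'
  have *: "tilt p y (x + x') \<le> (p (x + s *\<^sub>R y) - s * p y) + (p (x' + t *\<^sub>R y) - t * p y)"
    if "0 \<le> s" "0 \<le> t" for s t
  proof -
    have "tilt p y (x + x') \<le> p ((x + x') + (s + t) *\<^sub>R y) - (s + t) * p y"
      using that by (intro tilt_le p) simp
    moreover have "(x + x') + (s + t) *\<^sub>R y = (x + s *\<^sub>R y) + (x' + t *\<^sub>R y)"
      by (simp add: algebra_simps)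
    ultimately show ?thesis
      using sublinear_add[OF p, of "x + s *\<^sub>R y" "x' + t *\<^sub>R y"] by (simp add: algebra_simps)
  qed
  have "tilt p y (x + x') - (p (x + s *\<^sub>R y) - s * p y) \<le> tilt p y x'" if "0 \<le> s" for s
    by (rule tilt_greatest) (use *[OF that] in \<open>simp add: algebra_simps\<close>)
  then have "tilt p y (x + x') - tilt p y x' \<le> tilt p y x"
    by (intro tilt_greatest) (simp add: algebra_simps)
  then show "tilt p y (x + x') \<le> tilt p y x + tilt p y x'" by simp
next
  fix r :: real and x
  assume r: "0 < r"
  have "tilt p y (r *\<^sub>R x) / r \<le> p (x + t *\<^sub>R y) - t * p y" if "0 \<le> t" for t
  proof -
    have "tilt p y (r *\<^sub>R x) \<le> p (r *\<^sub>R x + (r * t) *\<^sub>R y) - (r * t) * p y"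
      using that r by (intro tilt_le p) simp
    also have "r *\<^sub>R x + (r * t) *\<^sub>R y = r *\<^sub>R (x + t *\<^sub>R y)"
      by (simp add: algebra_simps)
    also have "p \<dots> = r * p (x + t *\<^sub>R y)"
      using r by (intro sublinear_scaleR p) simp
    finally show ?thesis using r by (simp add: field_simps)
  qed
  then have "tilt p y (r *\<^sub>R x) / r \<le> tilt p y x" by (rule tilt_greatest)
  then show "tilt p y (r *\<^sub>R x) \<le> r * tilt p y x" using r by (simp add: field_simps)
qed

text \<open>The common lower bound \<open>- p (- x)\<close> makes the infimum genuine. Subadditivity
  uses the chain: of two members \<open>q\<close> and \<open>q'\<close>, the smaller one serves at
  both points.\<close>

lemma sublinear_INF_chain:
  assumes C: "C \<noteq> {}" "\<And>q. q \<in> C \<Longrightarrow> sublinear q \<and> q \<le> p"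
    and chain: "\<And>q q'. q \<in> C \<Longrightarrow> q' \<in> C \<Longrightarrow> q \<le> q' \<or> q' \<le> q"
  shows "sublinear (\<lambda>x. INF q\<in>C. q x)" and "q \<in> C \<Longrightarrow> (INF q\<in>C. q x) \<le> q x"
proof -
  let ?u = "\<lambda>x. INF q\<in>C. q x"
  have "- p (- x) \<le> q x" if "q \<in> C" for q x
    using sublinear_ge_minus[of q x] C(2)[OF that] le_funD[of q p "- x"] by force
  then have bdd: "bdd_below ((\<lambda>q. q x) ` C)" for x
    by (auto intro!: bdd_belowI)
  show low: "?u x \<le> q x" if "q \<in> C" for q x
    using bdd that by (rule cINF_lower)
  show "sublinear ?u"
    unfolding sublinear_def
  proof (intro conjI allI impI)
    fix x y
    have *: "?u (x + y) \<le> q x + q' y" if q: "q \<in> C" "q' \<in> C" for q q'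
    proof -
      obtain m where m: "m \<in> C" "m \<le> q" "m \<le> q'"
        using chain[OF q] q by blast
      have "?u (x + y) \<le> m (x + y)" by (rule low) fact
      also have "\<dots> \<le> m x + m y" using C(2)[OF m(1)] by (simp add: sublinear_add)
      also have "\<dots> \<le> q x + q' y" using m by (simp add: add_mono le_funD)
      finally show ?thesis .
    qed
    have "?u (x + y) - q x \<le> ?u y" if "q \<in> C" for q
      by (rule cINF_greatest[OF C(1)]) (use *[OF that] in \<open>simp add: algebra_simps\<close>)
    then have "?u (x + y) - ?u y \<le> ?u x"
      by (intro cINF_greatest[OF C(1)]) (simp add: algebra_simps)
    then show "?u (x + y) \<le> ?u x + ?u y" by simp
  next
    fix r :: real and x
    assume r: "0 < r"
    have "?u (r *\<^sub>R x) / r \<le> q x" if "q \<in> C" for q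
      using low[OF that, of "r *\<^sub>R x"] C(2)[OF that] r sublinear_scaleR[of q r x]
      by (simp add: field_simps)
    then have "?u (r *\<^sub>R x) / r \<le> ?u x" by (intro cINF_greatest[OF C(1)])
    then show "?u (r *\<^sub>R x) \<le> r * ?u x" using r by (simp add: field_simps)
  qed
qed

lemma linear_if_tilt_ge:
  assumes m: "sublinear m" and min: "\<And>x y. m x \<le> tilt m y x"
  shows "linear m"
proof -
  \<comment> \<open>The parameter \<open>t = 1\<close> in the tilt gives superadditivity.\<close>
  have "m x + m y \<le> m (x + y)" for x y
    using min[of x y] tilt_le[OF m, of 1 y x] by simp
  then have add: "m (x + y) = m x + m y" for x y
    using sublinear_add[OF m] by (intro antisym)
  then have neg: "m (- x) = - m x" for x
    using add[of x "- x"] sublinear_0[OF m] by simp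
  have "m (r *\<^sub>R x) = r * m x" for r x
    using sublinear_scaleR[OF m, of r x] sublinear_scaleR[OF m, of "- r" x] neg[of "r *\<^sub>R x"]
    by (cases "0 \<le> r") simp_all
  with add show ?thesis by (intro linearI) simp_all
qed

text \<open>Zorn's lemma for the reversed order yields a minimal sublinear functional below
  \<open>p\<close>. Its tilts are sublinear and below it, hence equal to it.\<close>

lemma linear_below_sublinear:
  assumes p: "sublinear p"
  shows "\<exists>u. linear u \<and> (\<forall>x. u x \<le> p x)"
proof -
  let ?A = "{q. sublinear q \<and> q \<le> p}"
  have "\<exists>m\<in>?A. \<forall>a\<in>?A. m \<ge> a \<longrightarrow> a = m"
  proof (rule predicate_Zorn)
    show "partial_order_on ?A (relation_of (\<ge>) ?A)"
      by (rule partial_order_on_relation_ofI) auto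
    fix C assume "C \<in> Chains (relation_of (\<ge>) ?A)"
    then have C: "\<And>q. q \<in> C \<Longrightarrow> sublinear q \<and> q \<le> p"
      and chain: "\<And>q q'. q \<in> C \<Longrightarrow> q' \<in> C \<Longrightarrow> q \<le> q' \<or> q' \<le> q"
      by (auto simp: Chains_def relation_of_def)
    show "\<exists>u\<in>?A. \<forall>a\<in>C. u \<le> a"
    proof (cases "C = {}")
      case True
      then show ?thesis using p by auto
    next
      case False
      note u = sublinear_INF_chain[OF False C chain]
      obtain q where "q \<in> C" using False by blast
      then have "(\<lambda>x. INF q\<in>C. q x) \<le> p"
        using u(2) C order_trans unfolding le_fun_def by blast
      then show ?thesis using u by (intro bexI[of _ "\<lambda>x. INF q\<in>C. q x"]) (auto simp: le_fun_def)
    qed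
  qed
  then obtain m where m: "sublinear m" "m \<le> p"
    and min: "\<And>a. sublinear a \<Longrightarrow> a \<le> m \<Longrightarrow> a = m"
    by (auto intro: order_trans)
  have "tilt m y = m" for y
    using m(1) by (intro min sublinear_tilt) (auto simp: le_fun_def tilt_le_self)
  then have "linear m" using m(1) by (intro linear_if_tilt_ge) simp_all
  with m(2) show ?thesis by (auto simp: le_fun_def)
qed

lemma real_supporting_functional:
  fixes z :: "'a::real_normed_vector"
  shows "\<exists>u. linear u \<and> (\<forall>x. u x \<le> norm x) \<and> u z = norm z"
proof -
  obtain u where u: "linear u" and le: "\<And>x. u x \<le> tilt norm z x"
    using linear_below_sublinear[OF sublinear_tilt[OF sublinear_norm]] by blast
  have norm: "u x \<le> norm x" for x
    using le[of x] tilt_le_self[OF sublinear_norm, of z x] by simp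
  \<comment> \<open>With \<open>t = 1\<close> the tilt at \<open>- z\<close> is at most
    \<open>norm 0 - norm z\<close>.\<close>
  have "u (- z) \<le> - norm z"
    using le[of "- z"] tilt_le[OF sublinear_norm, of 1 z "- z"] by simp
  then have "u z = norm z" using norm[of z] linear_neg[OF u, of z] by simp
  with u norm show ?thesis by blast
qed

section \<open>Norming functionals over both scalar fields\<close>

locale contractive_functional =
  fixes scale :: "'k::real_or_complex \<Rightarrow> 'e::real_normed_vector \<Rightarrow> 'e" and f :: "'e \<Rightarrow> 'k"
  assumes add: "f (x + y) = f x + f y"
    and scale: "f (scale a x) = a * f x"
    and norm_le: "norm (f x) \<le> norm x"

lemma (in normed_space_over) contractive_functional_0: "contractive_functional scale (\<lambda>_. 0)"
  by unfold_locales simp_all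

lemma ex_complex_embedding:
  "\<exists>\<phi> :: 'k::real_or_complex \<Rightarrow> complex.
     linear \<phi> \<and> (\<forall>x y. \<phi> (x * y) = \<phi> x * \<phi> y) \<and> (\<forall>x. norm (\<phi> x) = norm x) \<and>
     (\<forall>r. \<phi> (of_real r) = of_real r) \<and> (range \<phi> = \<real> \<or> range \<phi> = UNIV)"
proof -
  obtain \<phi> :: "'k \<Rightarrow> complex" where
    add: "\<And>x y. \<phi> (x + y) = \<phi> x + \<phi> y" and mult: "\<And>x y. \<phi> (x * y) = \<phi> x * \<phi> y"
    and sc: "\<And>r x. \<phi> (r *\<^sub>R x) = r *\<^sub>R \<phi> x" and norm: "\<And>x. norm (\<phi> x) = norm x"
    and ran: "range \<phi> = \<real> \<or> range \<phi> = UNIV"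
    using ex_real_or_complex_embedding by blast
  \<comment> \<open>\<open>\<phi> 1\<close> is a nonzero idempotent of a field, hence 1.\<close>
  have "\<phi> 1 \<noteq> 0" using norm[of 1] by auto
  then have "\<phi> 1 = 1" using mult[of 1 1] by simp
  then have "\<phi> (of_real r) = of_real r" for r
    using sc[of r 1] by (simp add: of_real_def)
  moreover have "linear \<phi>" by (rule linearI) (simp_all add: add sc)
  ultimately show ?thesis using mult norm ran by blast
qed

text \<open>A real functional \<open>u\<close> supporting \<open>z\<close> is the real part of a
  \<open>'k\<close>-linear \<open>f\<close>, and passing to \<open>f\<close> does not increase the
  norm.\<close>

lemma (in normed_space_over) supporting_functional:
  "\<exists>f. contractive_functional scale f \<and> norm (f z) = norm z"
proof -
  obtain u where u: "linear u" and le: "\<And>x. u x \<le> norm x" and uz: "u z = norm z"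
    using real_supporting_functional by blast
  obtain \<phi> :: "'k \<Rightarrow> complex" where \<phi>: "linear \<phi>" and mult: "\<And>x y. \<phi> (x * y) = \<phi> x * \<phi> y"
    and norm: "\<And>x. norm (\<phi> x) = norm x" and of_real: "\<And>r. \<phi> (of_real r) = of_real r"
    and ran: "range \<phi> = \<real> \<or> range \<phi> = UNIV"
    using ex_complex_embedding by blast
  have inj: "x = y" if "\<phi> x = \<phi> y" for x y
    using that norm[of "x - y"] linear_diff[OF \<phi>, of x y] by simp
  \<comment> \<open>A scalar \<open>a\<close> of norm 1 rotates \<open>f x\<close> onto the
    nonnegative reals, where it equals its real part \<open>u (scale a x)\<close>.\<close>
  have Re_le: "norm (f x) \<le> norm x"
    if f: "\<And>a x. f (scale a x) = a * f x" "\<And>x. Re (\<phi> (f x)) = u x" for f x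
  proof (cases "f x = 0")
    case False
    define a where "a = of_real (norm (f x)) / f x"
    have a: "norm a = 1" "a * f x = of_real (norm (f x))"
      using False by (simp_all add: a_def norm_divide)
    have "norm (f x) = Re (\<phi> (f (scale a x)))" by (simp add: f(1) a(2) of_real)
    also have "\<dots> \<le> norm (scale a x)" by (simp add: f(2) le)
    also have "\<dots> = norm x" by (simp add: norm_scale a(1))
    finally show ?thesis .
  qed simp
  have "\<exists>f. (\<forall>x y. f (x + y) = f x + f y) \<and> (\<forall>a x. f (scale a x) = a * f x) \<and>
            (\<forall>x. Re (\<phi> (f x)) = u x)"
    using ran
  proof
    assume ran: "range \<phi> = \<real>"
    have real: "\<exists>r. a = of_real r" for a :: 'k
    proof -
      have "\<phi> a \<in> \<real>" using ran by auto
      then obtain r where "\<phi> a = of_real r" by (auto simp: Reals_def)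
      then show ?thesis using inj[of a "of_real r"] of_real by auto
    qed
    have "of_real (u (scale a x)) = a * of_real (u x)" for a x
    proof -
      obtain r where "a = of_real r" using real by blast
      then show ?thesis by (simp add: scale_of_real linear_scale[OF u])
    qed
    then show ?thesis
      by (intro exI[of _ "\<lambda>x. of_real (u x)"]) (simp add: linear_add[OF u] of_real)
  next
    assume ran: "range \<phi> = UNIV"
    then obtain i where i: "\<phi> i = \<i>" by (metis surjD)
    have ii: "i * i = - 1"
      using of_real[of "-1"] by (intro inj) (simp add: mult i)
    have decomp: "a = of_real (Re (\<phi> a)) + of_real (Im (\<phi> a)) * i" for a
      by (intro inj) (simp add: linear_add[OF \<phi>] mult of_real i complex_eq_iff)
    \<comment> \<open>Linearity forces this formula: the real part at \<open>scale i x\<close> is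
      minus the imaginary part at \<open>x\<close>.\<close>
    let ?f = "\<lambda>x. of_real (u x) - i * of_real (u (scale i x))"
    have 1: "?f (x + y) = ?f x + ?f y" for x y
      by (simp add: linear_add[OF u] scale_right_distrib algebra_simps)
    have 2: "?f (scale (of_real r) x) = of_real r * ?f x" for r x
    proof -
      have "scale i (r *\<^sub>R x) = r *\<^sub>R scale i x"
        using scale_left_commute[of i "of_real r" x] by (simp only: scale_of_real)
      then show ?thesis by (simp add: scale_of_real linear_scale[OF u] algebra_simps)
    qed
    have 3: "?f (scale i x) = i * ?f x" for x
    proof -
      have "scale i (scale i x) = - x"
        using scale_scale[of i i x] by (simp add: ii)
      moreover have "i * ?f x = i * of_real (u x) - (i * i) * of_real (u (scale i x))"
        by (simp only: right_diff_distrib mult.assoc)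
      ultimately show ?thesis by (simp add: ii linear_neg[OF u])
    qed
    have "?f (scale a x) = a * ?f x" for a x
    proof -
      define r s where "r = Re (\<phi> a)" and "s = Im (\<phi> a)"
      have a: "a = of_real r + of_real s * i" using decomp by (simp add: r_def s_def)
      have "scale a x = scale (of_real r) x + scale (of_real s) (scale i x)"
        by (simp add: a scale_left_distrib)
      then have "?f (scale a x) = of_real r * ?f x + of_real s * (i * ?f x)"
        by (simp only: 1 2 3)
      then show ?thesis by (simp only: a distrib_right mult.assoc)
    qed
    moreover have "Re (\<phi> (?f x)) = u x" for x
      by (simp add: linear_diff[OF \<phi>] mult of_real i)
    ultimately show ?thesis using 1 by (intro exI[of _ ?f]) blast
  qed
  then obtain f where f: "\<And>x y. f (x + y) = f x + f y" "\<And>a x. f (scale a x) = a * f x"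
      "\<And>x. Re (\<phi> (f x)) = u x" by blast
  have nle: "norm (f x) \<le> norm x" for x by (rule Re_le) (fact f)+
  have "norm z \<le> norm (f z)"
    using complex_Re_le_cmod[of "\<phi> (f z)"] by (simp add: f(3) uz norm)
  then have "norm (f z) = norm z" using nle[of z] by simp
  moreover have "contractive_functional scale f" using f nle by unfold_locales
  ultimately show ?thesis by blast
qed

text \<open>Supporting functionals at the points of a countable dense set suffice: replacing
  \<open>x\<close> by a nearby \<open>z\<close> costs \<open>dist z x\<close> twice, once in the
  norm and once in the value of \<open>F z\<close>.\<close>

lemma (in normed_space_over) norming_sequence:
  assumes "separable_space (euclidean :: 'e topology)"
  obtains F where "\<And>n::nat. contractive_functional scale (F n)"
    and "\<And>x b. (\<And>n. norm (F n x) \<le> b) \<Longrightarrow> norm x \<le> b"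
proof -
  obtain C :: "'e set" where C: "countable C" "closure C = UNIV"
    using assms by (auto simp: separable_space_def)
  then have ne: "C \<noteq> {}" by auto
  obtain F where F: "\<And>z. contractive_functional scale (F z)" "\<And>z. norm (F z z) = norm z"
    using supporting_functional by metis
  show ?thesis
  proof (rule that[of "\<lambda>n. F (from_nat_into C n)"])
    fix x :: 'e and b
    assume b: "\<And>n. norm (F (from_nat_into C n) x) \<le> b"
    show "norm x \<le> b"
    proof (rule field_le_epsilon)
      fix e :: real assume "0 < e"
      then obtain z where z: "z \<in> C" "dist z x < e / 2"
        using C(2) closure_approachable[of x C] by (metis UNIV_I half_gt_zero)
      interpret contractive_functional scale "F z" by (rule F)
      have "norm (F z x) \<le> b" using b z(1) C(1) by (metis from_nat_into_surj)
      moreover have "norm (F z z) \<le> norm (F z x) + norm (F z (z - x))"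
        using add[of x "z - x"] norm_triangle_ineq[of "F z x" "F z (z - x)"] by simp
      moreover have "norm x \<le> norm z + norm (z - x)"
        using norm_triangle_ineq4[of z "z - x"] by simp
      ultimately show "norm x \<le> b + e"
        using norm_le[of "z - x"] z(2) F(2)[of z] by (simp add: dist_norm)
    qed
  qed (rule F)
qed

section \<open>Bounded sequences along a subsequence\<close>

text \<open>The diagonal argument runs over the countable index set \<open>S\<close>, in
  \<open>complex\<close> via \<open>\<phi>\<close>. Dividing by \<open>norm x\<close> gives a bound
  uniform in \<open>x\<close>.\<close>

lemma common_convergent_subsequence:
  fixes S :: "'k::real_or_complex linf set"
  assumes "countable S"
  obtains r :: "nat \<Rightarrow> nat" where "strict_mono r"
    and "\<And>x. x \<in> S \<Longrightarrow> convergent (\<lambda>n. apply_bcontfun x (r n))"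
proof -
  obtain \<phi> :: "'k \<Rightarrow> complex" where \<phi>: "linear \<phi>" and norm: "\<And>x. norm (\<phi> x) = norm x"
    using ex_complex_embedding by blast
  have dist: "dist (\<phi> a) (\<phi> b) = dist a b" for a b
    by (simp add: dist_norm linear_diff[OF \<phi>, symmetric] norm)
  have "norm (\<phi> (apply_bcontfun x n) /\<^sub>R norm x) \<le> 1" for n and x :: "'k linf"
    using norm_bounded[of x n] by (cases "x = 0") (simp_all add: norm field_simps)
  then obtain r :: "nat \<Rightarrow> nat" where r: "strict_mono r"
    and conv: "\<And>x. x \<in> S \<Longrightarrow> \<exists>l. (\<lambda>n. \<phi> (apply_bcontfun x (r n)) /\<^sub>R norm x) \<longlonglongrightarrow> l"
    using function_convergent_subsequence[OF assms,
        of "\<lambda>n x. \<phi> (apply_bcontfun x n) /\<^sub>R norm x" 1] by metis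
  have "convergent (\<lambda>n. apply_bcontfun x (r n))" if x: "x \<in> S" for x
  proof (cases "x = 0")
    case False
    from conv[OF x] obtain l where "(\<lambda>n. \<phi> (apply_bcontfun x (r n)) /\<^sub>R norm x) \<longlonglongrightarrow> l" by blast
    from tendsto_scaleR[OF tendsto_const[of "norm x"] this]
    have "convergent (\<lambda>n. \<phi> (apply_bcontfun x (r n)))"
      using False by (auto simp: convergent_def)
    \<comment> \<open>The Cauchy property pulls back along the isometry \<open>\<phi>\<close>, and
      \<open>'k\<close> is complete.\<close>
    then have "Cauchy (\<lambda>n. \<phi> (apply_bcontfun x (r n)))" by (rule convergent_Cauchy)
    then have "Cauchy (\<lambda>n. apply_bcontfun x (r n))"
      by (simp add: Cauchy_def dist)
    then show ?thesis by (simp add: Cauchy_convergent_iff)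
  qed (simp add: convergent_const)
  with r that show ?thesis by blast
qed

text \<open>An \<open>e / 3\<close> argument: the sequences converging along \<open>r\<close> are
  closed in the sup norm.\<close>

lemma convergent_subseq_if_close:
  fixes x :: "'k::real_or_complex linf"
  assumes "\<And>e. e > 0 \<Longrightarrow> \<exists>y. dist y x < e \<and> convergent (\<lambda>n. apply_bcontfun y (r n))"
  shows "convergent (\<lambda>n. apply_bcontfun x (r n))"
proof -
  have "Cauchy (\<lambda>n. apply_bcontfun x (r n))"
  proof (rule metric_CauchyI)
    fix e :: real assume "e > 0"
    then have "e / 3 > 0" by simp
    from assms[OF this] obtain y where y: "dist y x < e / 3"
      and "Cauchy (\<lambda>n. apply_bcontfun y (r n))" by (auto dest: convergent_Cauchy)
    then obtain M where
      M: "\<And>i j. i \<ge> M \<Longrightarrow> j \<ge> M \<Longrightarrow> dist (apply_bcontfun y (r i)) (apply_bcontfun y (r j)) < e / 3"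
      using \<open>e / 3 > 0\<close> metric_CauchyD by blast
    have "dist (apply_bcontfun x (r i)) (apply_bcontfun x (r j)) < e" if "i \<ge> M" "j \<ge> M" for i j
    proof -
      have "dist (apply_bcontfun y (r i)) (apply_bcontfun x (r i)) < e / 3"
        "dist (apply_bcontfun y (r j)) (apply_bcontfun x (r j)) < e / 3"
        using y dist_fun_lt_imp_dist_val_lt by blast+
      with M[OF that] show ?thesis by metric
    qed
    then show "\<exists>M. \<forall>i\<ge>M. \<forall>j\<ge>M. dist (apply_bcontfun x (r i)) (apply_bcontfun x (r j)) < e"
      by blast
  qed
  then show ?thesis by (simp add: Cauchy_convergent_iff)
qed

text \<open>Density in the quotient puts each element of \<open>D\<close> within \<open>e\<close> of
  some \<open>s + a\<close> with \<open>s\<close> in a fixed countable \<open>S\<close> and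
  \<open>a\<close> convergent; such sums converge along \<open>r\<close>.\<close>

lemma convergent_subsequence_of_separable_quotient:
  fixes D :: "'k::real_or_complex linf set"
  assumes "separable_space (top_of_set (quot_c ` D))"
  obtains r :: "nat \<Rightarrow> nat" where "strict_mono r"
    and "\<And>x. x \<in> D + conv_seqs \<Longrightarrow> convergent (\<lambda>n. apply_bcontfun x (r n))"
proof -
  obtain C where C: "countable C" "C \<subseteq> quot_c ` D"
    and dense: "top_of_set (quot_c ` D) closure_of C = quot_c ` D"
    using assms by (auto simp: separable_space_def)
  obtain S where S: "countable S" "S \<subseteq> D" "C = quot_c ` S"
    using C countable_subset_image by metis
  obtain r where r: "strict_mono r"
    and conv: "\<And>x. x \<in> S \<Longrightarrow> convergent (\<lambda>n. apply_bcontfun x (r n))"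
    using common_convergent_subsequence[OF S(1)] by blast
  have conv_c: "convergent (\<lambda>n. apply_bcontfun x (r n))" if "x \<in> conv_seqs" for x :: "'k linf"
    using convergent_subseq_convergent[OF _ r, of "apply_bcontfun x"] that
    by (simp add: conv_seqs_def comp_def)
  have conv_D: "convergent (\<lambda>n. apply_bcontfun x (r n))" if x: "x \<in> D" for x
  proof (rule convergent_subseq_if_close)
    fix e :: real assume "e > 0"
    have "quot_c x \<in> closure (quot_c ` S)"
      using dense x S C(2) by (auto simp: closure_of_subtopology Int_absorb1)
    then obtain s where s: "s \<in> S" "dist (quot_c s) (quot_c x) < e"
      using \<open>e > 0\<close> by (auto simp: closure_approachable)
    have "infdist (x - s) conv_seqs < e"
    proof -
      have "quot_c (x - s) = quot_c x - quot_c s"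
        by transfer (simp add: conv_seqs_0)
      then show ?thesis using s(2) by (simp add: dist_norm norm_minus_commute flip: norm_quot_c)
    qed
    \<comment> \<open>The quotient norm is an infimum, so a strict bound is attained by an actual
      convergent \<open>a\<close>.\<close>
    then obtain a where a: "a \<in> conv_seqs" "dist (x - s) a < e"
      using conv_seqs_0 cInf_lessD[of "dist (x - s) ` conv_seqs" e]
      by (force simp: infdist_def split: if_splits)
    have "dist (s + a) x < e"
      using a(2) by (simp add: dist_norm norm_minus_commute algebra_simps)
    moreover have "convergent (\<lambda>n. apply_bcontfun (s + a) (r n))"
      using conv[OF s(1)] conv_c[OF a(1)] by (simp add: plus_bcontfun.rep_eq convergent_add)
    ultimately show "\<exists>y. dist y x < e \<and> convergent (\<lambda>n. apply_bcontfun y (r n))" by blast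
  qed
  show ?thesis
  proof (rule that[OF r])
    fix x assume "x \<in> D + conv_seqs"
    then obtain d a where "d \<in> D" "a \<in> conv_seqs" "x = d + a" by (rule set_plus_elim)
    then show "convergent (\<lambda>n. apply_bcontfun x (r n))"
      using convergent_add[OF conv_D conv_c] by (simp add: plus_bcontfun.rep_eq)
  qed
qed

section \<open>Embedding the separable space by a sequence of functionals\<close>

lemma (in normed_space_over) operator_of_functionals:
  fixes G :: "nat \<Rightarrow> 'e \<Rightarrow> 'k"
  assumes G: "\<And>n. contractive_functional scale (G n)"
  obtains T :: "'e \<Rightarrow> 'k linf" where "Vector_Spaces.linear scale scale_linf T"
    and "\<And>x n. apply_bcontfun (T x) n = G n x" and "\<And>x. norm (T x) \<le> norm x"
proof -
  have "(\<lambda>n. G n x) \<in> bcontfun" for x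
    using contractive_functional.norm_le[OF G]
    by (intro bcontfun_normI[where b = "norm x"]) (auto intro!: continuous_intros)
  moreover define T :: "'e \<Rightarrow> 'k linf" where "T x = Bcontfun (\<lambda>n. G n x)" for x
  ultimately have T: "apply_bcontfun (T x) n = G n x" for x n
    by (simp add: Bcontfun_inverse)
  have "Vector_Spaces.linear scale scale_linf T"
    unfolding Vector_Spaces.linear_iff
    using contractive_functional.add[OF G] contractive_functional.scale[OF G]
    by (auto intro!: bcontfun_eqI simp: T plus_bcontfun.rep_eq vector_space_axioms
        linf.vector_space_axioms)
  moreover have "norm (T x) \<le> norm x" for x
    by (rule norm_bound) (simp add: T contractive_functional.norm_le[OF G])
  ultimately show ?thesis using T that by blast
qed

text \<open>Each \<open>h j\<close> occurs infinitely often in the sequence.\<close>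

lemma convergent_prod_decode_imp_eq:
  fixes h :: "nat \<Rightarrow> 'a::t2_space"
  assumes "convergent (\<lambda>m. h (fst (prod_decode m)))"
  shows "h i = h j"
proof -
  obtain l where l: "(\<lambda>m. h (fst (prod_decode m))) \<longlonglongrightarrow> l"
    using assms by (auto simp: convergent_def)
  have "h j = l" for j
  proof -
    \<comment> \<open>Since \<open>prod_encode (j, k)\<close> is at least \<open>k\<close>, the
      positions carrying \<open>h j\<close> tend to infinity.\<close>
    have "filterlim (\<lambda>k. prod_encode (j, k)) at_top sequentially"
      by (rule filterlim_at_top_mono[OF filterlim_ident]) (simp add: le_prod_encode_2)
    from filterlim_compose[OF l this] show ?thesis by (simp add: LIMSEQ_const_iff)
  qed
  then show ?thesis by simp
qed

theorem theorem3p3: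
  fixes D :: "'k::real_or_complex linf set"
    and scale :: "'k \<Rightarrow> 'e::banach \<Rightarrow> 'e"
  assumes D: "module.subspace scale_linf D"
    and D_c: "D \<inter> conv_seqs = {0}"
    and qD: "separable_space (top_of_set (quot_c ` D))"
    and E: "normed_space_over scale"
    and E_sep: "separable_space (euclidean :: 'e topology)"
  shows "\<exists>T :: 'e \<Rightarrow> 'k linf.
           Vector_Spaces.linear scale scale_linf T \<and> (\<forall>x. norm (T x) = norm x) \<and>
           range T \<inter> (D + conv_seqs) = {0} \<and>
           (D + range T) \<inter> conv_seqs = {0}"
proof -
  interpret E: normed_space_over scale by (rule E)
  obtain r where r: "strict_mono r"
    and conv: "\<And>x. x \<in> D + conv_seqs \<Longrightarrow> convergent (\<lambda>n. apply_bcontfun x (r n))"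
    using convergent_subsequence_of_separable_quotient[OF qD] by blast
  obtain F where F: "\<And>n::nat. contractive_functional scale (F n)"
    and norming: "\<And>x b. (\<And>n. norm (F n x) \<le> b) \<Longrightarrow> norm x \<le> b"
    using E.norming_sequence[OF E_sep] by blast
  \<comment> \<open>The zero functional takes index 0, so \<open>F n\<close> moves to index
    \<open>Suc n\<close>.\<close>
  define F0 where "F0 = case_nat (\<lambda>_. 0) F"
  define G where "G n = (if n \<in> range r then F0 (fst (prod_decode (inv r n))) else (\<lambda>_. 0))" for n
  have "contractive_functional scale (F0 j)" for j
    using F E.contractive_functional_0 by (auto simp: F0_def split: nat.split)
  then have "contractive_functional scale (G n)" for n
    using E.contractive_functional_0 by (simp add: G_def)
  then obtain T :: "'e \<Rightarrow> 'k linf" where lin: "Vector_Spaces.linear scale scale_linf T"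
    and T: "\<And>x n. apply_bcontfun (T x) n = G n x" and T_le: "\<And>x. norm (T x) \<le> norm x"
    using E.operator_of_functionals by blast
  have Tr: "apply_bcontfun (T x) (r m) = F0 (fst (prod_decode m)) x" for x m
    using strict_mono_imp_inj_on[OF r] by (simp add: T G_def)
  have iso: "norm (T x) = norm x" for x
  proof (rule antisym[OF T_le norming])
    fix n
    \<comment> \<open>Each \<open>F n x\<close> occurs as an entry of \<open>T x\<close>, which
      gives the lower norm bound.\<close>
    have "apply_bcontfun (T x) (r (prod_encode (Suc n, 0))) = F n x"
      by (simp add: Tr F0_def)
    then show "norm (F n x) \<le> norm (T x)" by (metis norm_bounded)
  qed
  have zero: "T x = 0" if "T x \<in> D + conv_seqs" for x
  proof -
    have "convergent (\<lambda>m. F0 (fst (prod_decode m)) x)"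
      using conv[OF that] by (simp add: Tr)
    \<comment> \<open>Convergence along \<open>r\<close> equates the value at index
      \<open>Suc n\<close> with the value 0 at index 0.\<close>
    from convergent_prod_decode_imp_eq[OF this, of "Suc _" 0] have "F n x = 0" for n
      by (simp add: F0_def)
    then have "norm x \<le> 0" by (intro norming) simp
    with iso[of x] show ?thesis by simp
  qed
  have 0: "0 \<in> D" "0 \<in> range T" "0 \<in> (conv_seqs :: 'k linf set)"
    using D_c iso[of 0] conv_seqs_0 by (auto intro: range_eqI[of _ _ 0])
  have "range T \<inter> (D + conv_seqs) = {0}"
    using zero 0 set_plus_intro[OF 0(1,3)] by auto
  moreover have "(D + range T) \<inter> conv_seqs = {0}"
  proof -
    have "d + T x = 0" if d: "d \<in> D" and c: "d + T x \<in> conv_seqs" for d x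
    proof -
      have "- d \<in> D" using linf.subspace_neg[OF D d] .
      \<comment> \<open>Here \<open>T x = - d + (d + T x)\<close> lies in
        \<open>D + conv_seqs\<close>; once \<open>T x = 0\<close>, the element \<open>d\<close>
        itself is in \<open>D \<inter> conv_seqs\<close>.\<close>
      from set_plus_intro[OF this c] have "T x = 0" by (intro zero) simp
      with c d D_c show ?thesis by auto
    qed
    then have "(D + range T) \<inter> conv_seqs \<subseteq> {0}" by (auto simp: set_plus_def)
    then show ?thesis using set_plus_intro[OF 0(1,2)] 0(3) by auto
  qed
  ultimately show ?thesis using lin iso by blast
qed

end
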